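(* Let $X$ and $Y$ be nonseparable Banach spaces belonging to the class $\mathcal E$, and let $f:B_{X^\ast}\to B_{Y^\ast}$ be a weak$^\ast$-to-weak$^\ast$ homeomorphism between their dual closed unit balls. Then $f$ is norm-to-norm continuous.
   Context: Compact spaces are Hausdorff. For a compact space $K$, $\mathcal Q(K)$ is the set of all Hausdorff quotient spaces $L=K/E$ ($E$ an equivalence relation on $K$, quotient topology), each with its canonical projection $p_L:K\to L$. It is ordered by: $L\le L'$ iff there is a continuous surjection $q:L'\to L$ (the natural projection) with $q\,p_{L'}=p_L$; equivalently, the equivalence relation of $L'$ is contained in that of $L$. Suprema in $\mathcal Q(K)$ correspond to intersections of equivalence relations. $\mathcal Q_\omega(K)\subset\mathcal Q(K)$ is the set of quotients of countable weight. A family $\mathcal S\subset\mathcal Q_\omega(K)$ is cofinal if for every $L\in\mathcal Q_\omega(K)$ there is $L'\in\mathcal S$ with $L\le L'$; it is a $\sigma$-semilattice if the supremum of every countable subset of $\mathcal S$ belongs to $\mathcal S$. Given a continuous surjection $\pi:M\to N$, a sequence $(x_n)$ in $N$ converging to $x\in N$ is called $\pi$-fiber convergent if for every $y\in\pi^{-1}(x)$ there are $y_n\in\pi^{-1}(x_n)$ with $y_n\to y$. If $K$ is a compact space of uncountable weight and $(x_n)$ is a sequence in $K$ converging to $x\in K$, then $(x_n)$ is called fiber convergent if there is a cofinal $\sigma$-semilattice $\mathcal S\subset\mathcal Q_\omega(K)$ such that for all $L'\le L$ in $\mathcal S$, with natural projection $\pi:L\to L'$, the sequence $(p_{L'}(x_n))_n$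 (which converges to $p_{L'}(x)$) is $\pi$-fiber convergent. A nonseparable Banach space $X$ belongs to the class $\mathcal E$ if the fiber convergent sequences of $(B_{X^\ast},w^\ast)$ are exactly the norm convergent sequences of $B_{X^\ast}$. Here $B_{X^\ast}$ is the closed unit ball of the dual $X^\ast$. *)

theory Defs
  imports "HOL-Analysis.Analysis"
begin

text \<open>A quotient of \<open>K\<close> is represented by its equivalence relation \<open>L\<close> on \<open>topspace K\<close>;
  the points of the quotient space are the equivalence classes.\<close>

definition quot_space :: "'a topology \<Rightarrow> ('a \<times> 'a) set \<Rightarrow> 'a set topology"
  where "quot_space K L =
    topology (\<lambda>\<U>. \<U> \<subseteq> topspace K // L \<and> openin K {x \<in> topspace K. L `` {x} \<in> \<U>})"

definition quot_proj :: "('a \<times> 'a) set \<Rightarrow> 'a \<Rightarrow> 'a set"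
  where "quot_proj L x = L `` {x}"

definition quots :: "'a topology \<Rightarrow> ('a \<times> 'a) set set"
  where "quots K = {L. equiv (topspace K) L \<and> Hausdorff_space (quot_space K L)}"

definition quots_omega :: "'a topology \<Rightarrow> ('a \<times> 'a) set set"
  where "quots_omega K = {L \<in> quots K. second_countable (quot_space K L)}"

text \<open>\<open>natural_projection K L' L q\<close>: the map \<open>q\<close> is a natural projection \<open>L' \<rightarrow> L\<close>.\<close>

definition natural_projection ::
    "'a topology \<Rightarrow> ('a \<times> 'a) set \<Rightarrow> ('a \<times> 'a) set \<Rightarrow> ('a set \<Rightarrow> 'a set) \<Rightarrow> bool"
  where "natural_projection K L' L q \<longleftrightarrow>
    continuous_map (quot_space K L') (quot_space K L) q \<and>
    q ` topspace (quot_space K L') = topspace (quot_space K L) \<and>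
    (\<forall>x\<in>topspace K. q (quot_proj L' x) = quot_proj L x)"

definition quot_le :: "'a topology \<Rightarrow> ('a \<times> 'a) set \<Rightarrow> ('a \<times> 'a) set \<Rightarrow> bool"
  where "quot_le K L L' \<longleftrightarrow> (\<exists>q. natural_projection K L' L q)"

text \<open>The supremum of a family of quotients is given by the intersection of the equivalence
  relations (inside \<open>topspace K \<times> topspace K\<close>, so that the supremum of the empty family is the
  one-point quotient); see \<open>quot_Sup_lub\<close> below.\<close>

definition quot_Sup :: "'a topology \<Rightarrow> ('a \<times> 'a) set set \<Rightarrow> ('a \<times> 'a) set"
  where "quot_Sup K \<A> = (topspace K \<times> topspace K) \<inter> \<Inter>\<A>"

definition cofinal_quots :: "'a topology \<Rightarrow> ('a \<times> 'a) set set \<Rightarrow> bool"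
  where "cofinal_quots K \<S> \<longleftrightarrow> (\<forall>L\<in>quots_omega K. \<exists>L'\<in>\<S>. quot_le K L L')"

definition sigma_semilattice :: "'a topology \<Rightarrow> ('a \<times> 'a) set set \<Rightarrow> bool"
  where "sigma_semilattice K \<S> \<longleftrightarrow> (\<forall>\<A>. \<A> \<subseteq> \<S> \<and> countable \<A> \<longrightarrow> quot_Sup K \<A> \<in> \<S>)"

lemma openin_quot_space:
  "openin (quot_space K L) \<U> \<longleftrightarrow>
    \<U> \<subseteq> topspace K // L \<and> openin K {x \<in> topspace K. L `` {x} \<in> \<U>}"
proof -
  have "istopology (\<lambda>\<U>. \<U> \<subseteq> topspace K // L \<and> openin K {x \<in> topspace K. L `` {x} \<in> \<U>})"
    unfolding istopology_def
  proof (intro conjI allI impI)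
    fix S T
    assume "S \<subseteq> topspace K // L \<and> openin K {x \<in> topspace K. L `` {x} \<in> S}"
      and "T \<subseteq> topspace K // L \<and> openin K {x \<in> topspace K. L `` {x} \<in> T}"
    moreover have "{x \<in> topspace K. L `` {x} \<in> S \<inter> T} =
        {x \<in> topspace K. L `` {x} \<in> S} \<inter> {x \<in> topspace K. L `` {x} \<in> T}" by auto
    ultimately show "openin K {x \<in> topspace K. L `` {x} \<in> S \<inter> T}" and "S \<inter> T \<subseteq> topspace K // L"
      by auto
  next
    fix \<K>
    assume *: "\<forall>S\<in>\<K>. S \<subseteq> topspace K // L \<and> openin K {x \<in> topspace K. L `` {x} \<in> S}"
    have "{x \<in> topspace K. L `` {x} \<in> \<Union>\<K>} = (\<Union>S\<in>\<K>. {x \<in> topspace K. L `` {x} \<in> S})" by auto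
    with * show "openin K {x \<in> topspace K. L `` {x} \<in> \<Union>\<K>}" by auto
    from * show "\<Union>\<K> \<subseteq> topspace K // L" by auto
  qed
  then show ?thesis unfolding quot_space_def by simp
qed

lemma topspace_quot_space [simp]: "topspace (quot_space K L) = topspace K // L"
proof
  show "topspace (quot_space K L) \<subseteq> topspace K // L"
    using openin_topspace openin_quot_space by blast
  have "{x \<in> topspace K. L `` {x} \<in> topspace K // L} = topspace K"
    by (auto simp: quotient_def)
  then have "openin (quot_space K L) (topspace K // L)"
    by (simp add: openin_quot_space)
  then show "topspace K // L \<subseteq> topspace (quot_space K L)"
    by (rule openin_subset)
qed

lemma quotient_map_quot_proj: "quotient_map K (quot_space K L) (quot_proj L)"
  by (auto simp: quotient_map_def openin_quot_space quot_proj_def quotient_def)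

lemma natural_projection_unique:
  assumes "natural_projection K L' L q" "natural_projection K L' L r"
    and "c \<in> topspace (quot_space K L')"
  shows "q c = r c"
  using assms by (auto simp: natural_projection_def quot_proj_def quotient_def)

lemma quot_le_iff:
  assumes "equiv (topspace K) L" "equiv (topspace K) L'"
  shows "quot_le K L L' \<longleftrightarrow> L' \<subseteq> L"
proof
  assume "quot_le K L L'"
  then obtain q where q: "\<forall>x\<in>topspace K. q (L' `` {x}) = L `` {x}"
    by (auto simp: quot_le_def natural_projection_def quot_proj_def)
  show "L' \<subseteq> L"
  proof clarify
    fix x y assume "(x, y) \<in> L'"
    then have "x \<in> topspace K" "y \<in> topspace K" "L' `` {x} = L' `` {y}"
      using equiv_class_eq_iff[OF assms(2)] by blast+
    with q show "(x, y) \<in> L"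
      using equiv_class_eq_iff[OF assms(1)] by metis
  qed
next
  assume sub: "L' \<subseteq> L"
  define q where "q c = L `` c" for c
  have q: "q (L' `` {x}) = L `` {x}" if "x \<in> topspace K" for x
  proof -
    have "L `` {y} = L `` {x}" if "(x, y) \<in> L'" for y
      using equiv_class_eq[OF assms(1)] sub that by blast
    moreover have "(x, x) \<in> L'"
      using assms(2) \<open>x \<in> topspace K\<close> by (meson equiv_def refl_onD)
    ultimately show ?thesis unfolding q_def by blast
  qed
  have comp: "continuous_map K (quot_space K L) (q \<circ> quot_proj L')"
    by (rule continuous_map_eq[OF quotient_imp_continuous_map[OF quotient_map_quot_proj]])
      (simp add: q quot_proj_def)
  have "continuous_map (quot_space K L') (quot_space K L) q"
    using continuous_compose_quotient_map[OF quotient_map_quot_proj comp] .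
  moreover have "q ` (topspace K // L') = topspace K // L"
  proof -
    have "topspace K // L' = (\<lambda>x. L' `` {x}) ` topspace K"
      and "topspace K // L = (\<lambda>x. L `` {x}) ` topspace K"
      by (auto simp: quotient_def)
    then show ?thesis by (simp add: image_image q)
  qed
  ultimately show "quot_le K L L'"
    unfolding quot_le_def natural_projection_def
    by (intro exI[of _ q]) (simp add: q quot_proj_def)
qed

lemma equiv_quot_Sup:
  assumes "\<And>L. L \<in> \<A> \<Longrightarrow> equiv (topspace K) L"
  shows "equiv (topspace K) (quot_Sup K \<A>)"
proof (rule equivI)
  show "quot_Sup K \<A> \<subseteq> topspace K \<times> topspace K"
    by (auto simp: quot_Sup_def)
  show "refl_on (topspace K) (quot_Sup K \<A>)"
    using assms by (auto simp: quot_Sup_def refl_on_def equiv_def)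
  show "sym (quot_Sup K \<A>)"
    using assms by (auto simp: quot_Sup_def equiv_def intro!: symI dest: symD)
  show "trans (quot_Sup K \<A>)"
    using assms by (fastforce simp: quot_Sup_def equiv_def intro!: transI elim: transE)
qed

lemma quot_Sup_lub:
  assumes "\<A> \<subseteq> quots K"
  shows "quot_Sup K \<A> \<in> quots K"
    and "\<And>L. L \<in> \<A> \<Longrightarrow> quot_le K L (quot_Sup K \<A>)"
    and "\<And>M. M \<in> quots K \<Longrightarrow> (\<And>L. L \<in> \<A> \<Longrightarrow> quot_le K L M) \<Longrightarrow> quot_le K (quot_Sup K \<A>) M"
proof -
  have eq: "equiv (topspace K) L" if "L \<in> \<A>" for L
    using assms that by (auto simp: quots_def)
  note eS = equiv_quot_Sup[of \<A> K, OF eq]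
  show le: "quot_le K L (quot_Sup K \<A>)" if "L \<in> \<A>" for L
    using that quot_le_iff[OF eq eS] by (auto simp: quot_Sup_def)
  show "quot_le K (quot_Sup K \<A>) M"
    if "M \<in> quots K" "\<And>L. L \<in> \<A> \<Longrightarrow> quot_le K L M" for M
  proof -
    have M: "equiv (topspace K) M" using that by (auto simp: quots_def)
    have "M \<subseteq> L" if "L \<in> \<A>" for L
      using quot_le_iff[OF eq M] that \<open>\<And>L. L \<in> \<A> \<Longrightarrow> quot_le K L M\<close> by blast
    moreover have "M \<subseteq> topspace K \<times> topspace K"
      using M by (simp add: equiv_def)
    ultimately show ?thesis
      using quot_le_iff[OF eS M] by (auto simp: quot_Sup_def)
  qed
  have "Hausdorff_space (quot_space K (quot_Sup K \<A>))"
    unfolding Hausdorff_space_def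
  proof (intro allI impI)
    fix c d
    assume "c \<in> topspace (quot_space K (quot_Sup K \<A>)) \<and>
      d \<in> topspace (quot_space K (quot_Sup K \<A>)) \<and> c \<noteq> d"
    then obtain x y where x: "x \<in> topspace K" "c = quot_proj (quot_Sup K \<A>) x"
      and y: "y \<in> topspace K" "d = quot_proj (quot_Sup K \<A>) y" and "c \<noteq> d"
      by (auto simp: quotient_def quot_proj_def)
    then have "(x, y) \<notin> quot_Sup K \<A>"
      using equiv_class_eq[OF eS] by (auto simp: quot_proj_def)
    then obtain L where L: "L \<in> \<A>" "(x, y) \<notin> L"
      using x y by (auto simp: quot_Sup_def)
    obtain q where q: "natural_projection K (quot_Sup K \<A>) L q"
      using le[OF L(1)] by (auto simp: quot_le_def)
    then have cont: "continuous_map (quot_space K (quot_Sup K \<A>)) (quot_space K L) q"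
      and qc: "q c = quot_proj L x" "q d = quot_proj L y"
      using x y by (auto simp: natural_projection_def)
    have "quot_proj L x \<noteq> quot_proj L y"
      using L eq_equiv_class[OF _ eq] y by (auto simp: quot_proj_def)
    moreover have "quot_proj L x \<in> topspace (quot_space K L)"
      "quot_proj L y \<in> topspace (quot_space K L)"
      using x y by (auto simp: quot_proj_def quotient_def)
    moreover have "Hausdorff_space (quot_space K L)"
      using L assms by (auto simp: quots_def)
    ultimately obtain U V where UV: "openin (quot_space K L) U" "openin (quot_space K L) V"
      "quot_proj L x \<in> U" "quot_proj L y \<in> V" "disjnt U V"
      unfolding Hausdorff_space_def by meson
    let ?P = "\<lambda>W. {z \<in> topspace (quot_space K (quot_Sup K \<A>)). q z \<in> W}"
    have "openin (quot_space K (quot_Sup K \<A>)) (?P U)"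
      "openin (quot_space K (quot_Sup K \<A>)) (?P V)"
      using cont UV by (blast intro: openin_continuous_map_preimage)+
    moreover have "c \<in> ?P U" "d \<in> ?P V"
      using x y qc UV by (auto simp: quot_proj_def quotient_def)
    moreover have "disjnt (?P U) (?P V)"
      using UV by (auto simp: disjnt_def)
    ultimately show "\<exists>U V. openin (quot_space K (quot_Sup K \<A>)) U \<and>
        openin (quot_space K (quot_Sup K \<A>)) V \<and> c \<in> U \<and> d \<in> V \<and> disjnt U V"
      by blast
  qed
  with eS show "quot_Sup K \<A> \<in> quots K"
    by (simp add: quots_def)
qed

text \<open>Used for continuous surjections \<open>\<pi>\<close> from \<open>M\<close> onto \<open>N\<close>.\<close>

definition map_fiber_convergent ::
    "'a topology \<Rightarrow> 'b topology \<Rightarrow> ('a \<Rightarrow> 'b) \<Rightarrow> (nat \<Rightarrow> 'b) \<Rightarrow> 'b \<Rightarrow> bool"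
  where "map_fiber_convergent M N \<pi> xs x \<longleftrightarrow>
    range xs \<subseteq> topspace N \<and> limitin N xs x sequentially \<and>
    (\<forall>y\<in>topspace M. \<pi> y = x \<longrightarrow>
      (\<exists>ys. (\<forall>n. ys n \<in> topspace M \<and> \<pi> (ys n) = xs n) \<and> limitin M ys y sequentially))"

text \<open>Used for compact Hausdorff \<open>K\<close> of uncountable weight.\<close>

definition fiber_convergent :: "'a topology \<Rightarrow> (nat \<Rightarrow> 'a) \<Rightarrow> 'a \<Rightarrow> bool"
  where "fiber_convergent K xs x \<longleftrightarrow>
    range xs \<subseteq> topspace K \<and> limitin K xs x sequentially \<and>
    (\<exists>\<S>\<subseteq>quots_omega K. cofinal_quots K \<S> \<and> sigma_semilattice K \<S> \<and>
      (\<forall>L\<in>\<S>. \<forall>L'\<in>\<S>. \<forall>\<pi>. natural_projection K L L' \<pi> \<longrightarrow>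
        map_fiber_convergent (quot_space K L) (quot_space K L') \<pi>
          (\<lambda>n. quot_proj L' (xs n)) (quot_proj L' x)))"

text \<open>On the dual \<open>'a \<Rightarrow>\<^sub>L real\<close>, the strong operator topology is the topology of pointwise
  convergence, i.e. the weak* topology.\<close>

definition dual_ball :: "('a::real_normed_vector \<Rightarrow>\<^sub>L real) topology"
  where "dual_ball = subtopology strong_operator_topology (cball 0 1)"

definition class_E :: "'a::banach itself \<Rightarrow> bool"
  where "class_E _ \<longleftrightarrow>
    \<not> separable_space (euclidean :: 'a topology) \<and>
    {xs. \<exists>x. fiber_convergent (dual_ball :: ('a \<Rightarrow>\<^sub>L real) topology) xs x} =
    {xs. range xs \<subseteq> cball 0 1 \<and> convergent xs}"

end

theory Submission
  imports Defs
begin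

text \<open>Fiber convergence is a topological invariant: a homeomorphism carries quotients of countable
  weight, their order and their countable suprema from one space to the other. Within the class
  \<open>\<E>\<close> norm convergence of sequences in the dual ball is therefore expressed by the weak* topology
  alone. The norm limit and the weak* limit of a sequence agree since norm convergence implies
  weak* convergence and the weak* topology is Hausdorff.\<close>

section \<open>Transport of relations along a homeomorphism\<close>

text \<open>In terms of quotients, this carries a quotient of \<open>K\<close> to the corresponding
  quotient of \<open>K'\<close> when \<open>f\<close> is a homeomorphism between them.\<close>

definition push_rel :: "('a \<Rightarrow> 'b) \<Rightarrow> ('a \<times> 'a) set \<Rightarrow> ('b \<times> 'b) set"
  where "push_rel f L = map_prod f f ` L"

lemma push_rel_mono: "L \<subseteq> M \<Longrightarrow> push_rel f L \<subseteq> push_rel f M"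
  by (auto simp: push_rel_def)

text \<open>The bound on \<open>L\<close> matters because \<open>g\<close> inverts \<open>f\<close>
  only on \<open>topspace K\<close>. This lets every statement about \<open>push_rel f\<close> be
  reversed by applying \<open>push_rel g\<close>.\<close>

lemma push_rel_inverse:
  assumes "homeomorphic_maps K K' f g" "L \<subseteq> topspace K \<times> topspace K"
  shows "push_rel g (push_rel f L) = L"
proof -
  have "map_prod g g (map_prod f f p) = p" if "p \<in> L" for p
    using assms that by (cases p) (auto simp: homeomorphic_maps_def)
  then show ?thesis by (simp add: push_rel_def image_image)
qed

text \<open>Classes go to classes, so \<open>image f\<close> is the map that \<open>f\<close>
  induces between the points of the two quotients.\<close>

lemma push_rel_Image:
  assumes "homeomorphic_maps K K' f g" "L \<subseteq> topspace K \<times> topspace K" "x \<in> topspace K"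
  shows "push_rel f L `` {f x} = f ` (L `` {x})"
proof -
  have gf: "g (f z) = z" if "z \<in> topspace K" for z
    using assms(1) that by (simp add: homeomorphic_maps_def)
  \<comment> \<open>A pair in \<open>push_rel f L\<close> starting at \<open>f x\<close> comes from
    some \<open>(a, b)\<close> in \<open>L\<close>; injectivity of \<open>f\<close> forces
    \<open>a\<close> to be \<open>x\<close>.\<close>
  have "a = x" if "(a, b) \<in> L" "f x = f a" for a b
  proof -
    have "a \<in> topspace K" using assms(2) that(1) by blast
    with gf[of a] gf[OF assms(3)] that(2) show ?thesis by simp
  qed
  then have "y \<in> f ` (L `` {x})" if "(f x, y) \<in> push_rel f L" for y
    using that unfolding push_rel_def by fastforce
  moreover have "(f x, f b) \<in> push_rel f L" if "(x, b) \<in> L" for b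
    unfolding push_rel_def using imageI[OF that, of "map_prod f f"] by simp
  ultimately show ?thesis by blast
qed

text \<open>Surjectivity of \<open>f\<close> onto \<open>topspace K'\<close> gives reflexivity, and
  injectivity gives transitivity.\<close>

lemma equiv_push_rel:
  assumes fg: "homeomorphic_maps K K' f g" and L: "equiv (topspace K) L"
  shows "equiv (topspace K') (push_rel f L)"
proof (rule equivI)
  have f: "homeomorphic_map K K' f" using fg by (simp add: homeomorphic_maps_map)
  note inj = homeomorphic_imp_injective_map[OF f] and im = homeomorphic_imp_surjective_map[OF f]
  have sub: "L \<subseteq> topspace K \<times> topspace K" using L by (simp add: equiv_def)
  show "push_rel f L \<subseteq> topspace K' \<times> topspace K'"
    using sub im by (auto simp: push_rel_def)
  show "refl_on (topspace K') (push_rel f L)"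
  proof (rule refl_onI)
    fix y assume "y \<in> topspace K'"
    then obtain x where x: "x \<in> topspace K" "y = f x" using im by blast
    then have "(x, x) \<in> L" using L by (meson equiv_def refl_onD)
    from imageI[OF this, of "map_prod f f"] x(2) show "(y, y) \<in> push_rel f L"
      by (simp add: push_rel_def)
  qed
  show "sym (push_rel f L)"
  proof (rule symI)
    fix a b assume "(a, b) \<in> push_rel f L"
    then obtain x y where *: "(x, y) \<in> L" "a = f x" "b = f y" by (auto simp: push_rel_def)
    then have "(y, x) \<in> L" using L by (meson equiv_def symD)
    from imageI[OF this, of "map_prod f f"] * show "(b, a) \<in> push_rel f L"
      by (simp add: push_rel_def)
  qed
  show "trans (push_rel f L)"
  proof (rule transI)
    fix a b c assume "(a, b) \<in> push_rel f L" "(b, c) \<in> push_rel f L"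
    then obtain x y y' z where *: "(x, y) \<in> L" "(y', z) \<in> L"
      "a = f x" "b = f y" "b = f y'" "c = f z"
      by (auto simp: push_rel_def)
    \<comment> \<open>The two pairs are lifted separately, so their middle points agree only after
      applying \<open>f\<close>.\<close>
    with sub inj have "y = y'" by (auto dest: inj_onD)
    with * L have "(x, z) \<in> L" by (meson equiv_def transD)
    from imageI[OF this, of "map_prod f f"] * show "(a, c) \<in> push_rel f L"
      by (simp add: push_rel_def)
  qed
qed

section \<open>Induced homeomorphisms of quotient spaces\<close>

text \<open>By the universal property of the quotient map it suffices to compose with
  \<open>quot_proj L\<close>; the composite agrees on \<open>topspace K\<close> with
  \<open>f\<close> followed by the projection of \<open>K'\<close>.\<close>

lemma continuous_map_quot_space_image:
  assumes fg: "homeomorphic_maps K K' f g" and L: "equiv (topspace K) L"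
  shows "continuous_map (quot_space K L) (quot_space K' (push_rel f L)) (image f)"
proof (rule continuous_compose_quotient_map[OF quotient_map_quot_proj])
  have sub: "L \<subseteq> topspace K \<times> topspace K" using L by (simp add: equiv_def)
  have "continuous_map K (quot_space K' (push_rel f L)) (quot_proj (push_rel f L) \<circ> f)"
    using fg quotient_imp_continuous_map[OF quotient_map_quot_proj]
    by (auto simp: homeomorphic_maps_def intro: continuous_map_compose)
  then show "continuous_map K (quot_space K' (push_rel f L)) (image f \<circ> quot_proj L)"
    by (rule continuous_map_eq) (simp add: quot_proj_def push_rel_Image[OF fg sub])
qed

text \<open>The inverse is continuous by the same lemma applied to \<open>g\<close> and
  \<open>push_rel f L\<close>, because \<open>push_rel g\<close> leads back to
  \<open>L\<close>.\<close>

lemma homeomorphic_maps_quot_space: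
  assumes fg: "homeomorphic_maps K K' f g" and L: "equiv (topspace K) L"
  shows "homeomorphic_maps (quot_space K L) (quot_space K' (push_rel f L)) (image f) (image g)"
proof -
  have gf: "homeomorphic_maps K' K g f" using fg homeomorphic_maps_sym by blast
  have L': "equiv (topspace K') (push_rel f L)" by (rule equiv_push_rel[OF fg L])
  have sub: "L \<subseteq> topspace K \<times> topspace K" using L by (simp add: equiv_def)
  \<comment> \<open>Stated for arbitrary spaces so that it serves both \<open>f\<close> and
    \<open>g\<close>.\<close>
  have inv: "h ` k ` c = c"
    if "homeomorphic_maps A B k h" "equiv (topspace A) M" "c \<in> topspace A // M"
    for A :: "'x topology" and B :: "'y topology" and h k M c
  proof -
    have "c \<subseteq> topspace A" using that(2,3) by (auto simp: quotient_def equiv_def)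
    moreover have "\<forall>x\<in>topspace A. h (k x) = x" using that(1) by (simp add: homeomorphic_maps_def)
    ultimately have "(\<lambda>x. h (k x)) ` c = id ` c" by (intro image_cong) auto
    then show ?thesis by (simp add: image_image)
  qed
  show ?thesis
    unfolding homeomorphic_maps_def
    using continuous_map_quot_space_image[OF fg L] continuous_map_quot_space_image[OF gf L']
      inv[OF fg L] inv[OF gf L'] by (simp add: push_rel_inverse[OF fg sub])
qed

lemma push_rel_quots_omega:
  assumes fg: "homeomorphic_maps K K' f g" and "L \<in> quots_omega K"
  shows "push_rel f L \<in> quots_omega K'"
proof -
  have L: "equiv (topspace K) L" using assms by (simp add: quots_omega_def quots_def)
  have "quot_space K L homeomorphic_space quot_space K' (push_rel f L)"
    using homeomorphic_maps_quot_space[OF fg L] homeomorphic_space_def by blast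
  then show ?thesis
    using assms(2) equiv_push_rel[OF fg L] homeomorphic_Hausdorff_space homeomorphic_space_second_countability
    unfolding quots_omega_def quots_def by blast
qed

text \<open>Images need not commute with intersections, so only one inclusion is direct; the other
  follows by pulling back along \<open>g\<close> and pushing forward again.\<close>

lemma push_rel_quot_Sup:
  assumes fg: "homeomorphic_maps K K' f g" and \<A>: "\<And>L. L \<in> \<A> \<Longrightarrow> equiv (topspace K) L"
  shows "push_rel f (quot_Sup K \<A>) = quot_Sup K' (push_rel f ` \<A>)"
proof
  have gf: "homeomorphic_maps K' K g f" using fg homeomorphic_maps_sym by blast
  have im: "f ` topspace K = topspace K'"
    using fg by (intro homeomorphic_imp_surjective_map) (simp add: homeomorphic_maps_map)
  show "push_rel f (quot_Sup K \<A>) \<subseteq> quot_Sup K' (push_rel f ` \<A>)"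
    using im by (auto simp: quot_Sup_def push_rel_def)
  have sub: "quot_Sup K' (push_rel f ` \<A>) \<subseteq> topspace K' \<times> topspace K'"
    by (auto simp: quot_Sup_def)
  have "push_rel g (quot_Sup K' (push_rel f ` \<A>)) \<subseteq> quot_Sup K \<A>"
  proof -
    have "push_rel g (quot_Sup K' (push_rel f ` \<A>)) \<subseteq> topspace K \<times> topspace K"
      using fg by (auto simp: quot_Sup_def push_rel_def homeomorphic_maps_def continuous_map_def)
    moreover have "push_rel g (quot_Sup K' (push_rel f ` \<A>)) \<subseteq> L" if "L \<in> \<A>" for L
    proof -
      have "push_rel g (quot_Sup K' (push_rel f ` \<A>)) \<subseteq> push_rel g (push_rel f L)"
        using that by (intro push_rel_mono) (auto simp: quot_Sup_def)
      then show ?thesis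
        using push_rel_inverse[OF fg] \<A>[OF that] by (simp add: equiv_def)
    qed
    ultimately show ?thesis by (auto simp: quot_Sup_def)
  qed
  then show "quot_Sup K' (push_rel f ` \<A>) \<subseteq> push_rel f (quot_Sup K \<A>)"
    using push_rel_mono push_rel_inverse[OF gf sub] by metis
qed

section \<open>Topological invariance of fiber convergence\<close>

text \<open>In a commuting square from \<pi> to \<open>\<pi>'\<close>, a point over
  \<open>k x\<close> is moved to \<open>M\<close> by \<open>h'\<close>, approximated there along the
  fibers of \<pi>, and the approximating sequence is returned by \<open>h\<close>.\<close>

lemma map_fiber_convergent_homeomorphic:
  assumes hM: "homeomorphic_maps M M' h h'" and cN: "continuous_map N N' k"
    and inj: "inj_on k (topspace N)" and sq: "\<And>y. y \<in> topspace M \<Longrightarrow> \<pi>' (h y) = k (\<pi> y)"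
    and \<pi>: "\<pi> ` topspace M \<subseteq> topspace N"
    and fc: "map_fiber_convergent M N \<pi> xs x"
  shows "map_fiber_convergent M' N' \<pi>' (\<lambda>n. k (xs n)) (k x)"
  unfolding map_fiber_convergent_def
proof (intro conjI ballI impI)
  have r: "range xs \<subseteq> topspace N" and l: "limitin N xs x sequentially"
    using fc by (auto simp: map_fiber_convergent_def)
  show "range (\<lambda>n. k (xs n)) \<subseteq> topspace N'"
    using r continuous_map_image_subset_topspace[OF cN] by blast
  show "limitin N' (\<lambda>n. k (xs n)) (k x) sequentially"
    using continuous_map_limit[OF cN l] by (simp add: o_def)
  fix y assume y: "y \<in> topspace M'" "\<pi>' y = k x"
  have h: "h' y \<in> topspace M" "h (h' y) = y" and ch: "continuous_map M M' h"
    using hM y by (auto simp: homeomorphic_maps_def continuous_map_def)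
  \<comment> \<open>Injectivity of \<open>k\<close> then places \<open>h' y\<close> in the fiber
    over \<open>x\<close> itself.\<close>
  have "k (\<pi> (h' y)) = k x" using sq[OF h(1)] h(2) y(2) by simp
  moreover have "x \<in> topspace N" using l by (rule limitin_topspace)
  ultimately have "\<pi> (h' y) = x" using inj \<pi> h(1) by (auto dest: inj_onD)
  then obtain ys where ys: "\<And>n. ys n \<in> topspace M \<and> \<pi> (ys n) = xs n"
      "limitin M ys (h' y) sequentially"
    using fc h(1) unfolding map_fiber_convergent_def by blast
  have "h (ys n) \<in> topspace M' \<and> \<pi>' (h (ys n)) = k (xs n)" for n
    using ys(1)[of n] sq ch by (auto simp: continuous_map_def)
  moreover have "limitin M' (\<lambda>n. h (ys n)) y sequentially"
    using continuous_map_limit[OF ch ys(2)] h(2) by (simp add: o_def)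
  ultimately show "\<exists>ys. (\<forall>n. ys n \<in> topspace M' \<and> \<pi>' (ys n) = k (xs n)) \<and>
      limitin M' ys y sequentially"
    by (intro exI[of _ "\<lambda>n. h (ys n)"]) simp
qed

lemma fiber_convergent_homeomorphic:
  assumes fg: "homeomorphic_maps K K' f g" and fc: "fiber_convergent K xs x"
  shows "fiber_convergent K' (\<lambda>n. f (xs n)) (f x)"
proof -
  have gf: "homeomorphic_maps K' K g f" using fg homeomorphic_maps_sym by blast
  have cf: "continuous_map K K' f" using fg by (simp add: homeomorphic_maps_def)
  obtain \<S> where S: "\<S> \<subseteq> quots_omega K" "cofinal_quots K \<S>" "sigma_semilattice K \<S>"
    and fcS: "\<And>L L' \<pi>. \<lbrakk>L \<in> \<S>; L' \<in> \<S>; natural_projection K L L' \<pi>\<rbrakk> \<Longrightarrow>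
        map_fiber_convergent (quot_space K L) (quot_space K L') \<pi>
          (\<lambda>n. quot_proj L' (xs n)) (quot_proj L' x)"
    using fc unfolding fiber_convergent_def by metis
  have r: "range xs \<subseteq> topspace K" and l: "limitin K xs x sequentially"
    using fc by (auto simp: fiber_convergent_def)
  have eqv: "equiv (topspace A) M" if "M \<in> quots_omega A" for A :: "'x topology" and M
    using that by (simp add: quots_omega_def quots_def)
  have rel: "M \<subseteq> topspace A \<times> topspace A" if "M \<in> quots_omega A" for A :: "'x topology" and M
    using that by (simp add: quots_omega_def quots_def equiv_def)
  have S': "push_rel f ` \<S> \<subseteq> quots_omega K'"
    using S(1) push_rel_quots_omega[OF fg] by blast
  have cof: "cofinal_quots K' (push_rel f ` \<S>)"
    unfolding cofinal_quots_def
  proof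
    fix M assume M: "M \<in> quots_omega K'"
    \<comment> \<open>Cofinality: pull \<open>M\<close> back to \<open>K\<close>, dominate it within
      \<open>\<S>\<close>, and push the dominating quotient forward.\<close>
    have gM: "push_rel g M \<in> quots_omega K" by (rule push_rel_quots_omega[OF gf M])
    then obtain L where L: "L \<in> \<S>" "quot_le K (push_rel g M) L"
      using S(2) by (auto simp: cofinal_quots_def)
    then have LK: "L \<in> quots_omega K" using S(1) by blast
    have "L \<subseteq> push_rel g M" using L(2) quot_le_iff[OF eqv[OF gM] eqv[OF LK]] by blast
    then have "push_rel f L \<subseteq> M"
      using push_rel_mono push_rel_inverse[OF gf rel[OF M]] by metis
    then have "quot_le K' M (push_rel f L)"
      using quot_le_iff[OF eqv[OF M] eqv[OF push_rel_quots_omega[OF fg LK]]] by blast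
    with L(1) show "\<exists>L'\<in>push_rel f ` \<S>. quot_le K' M L'" by blast
  qed
  have semi: "sigma_semilattice K' (push_rel f ` \<S>)"
    unfolding sigma_semilattice_def
  proof (intro allI impI)
    fix \<B> assume "\<B> \<subseteq> push_rel f ` \<S> \<and> countable \<B>"
    \<comment> \<open>Only a countable family of preimages is chosen, so that the semilattice
      property of \<open>\<S>\<close> applies to it.\<close>
    then obtain \<A> where A: "\<A> \<subseteq> \<S>" "countable \<A>" "\<B> = push_rel f ` \<A>"
      using countable_subset_image[of \<B> "push_rel f" \<S>] by blast
    have "quot_Sup K \<A> \<in> \<S>" using A S(3) by (simp add: sigma_semilattice_def)
    moreover have "push_rel f (quot_Sup K \<A>) = quot_Sup K' \<B>"
      unfolding A(3) using A(1) S(1) eqv by (intro push_rel_quot_Sup[OF fg]) blast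
    ultimately show "quot_Sup K' \<B> \<in> push_rel f ` \<S>" by force
  qed
  have mfc: "map_fiber_convergent (quot_space K' (push_rel f L)) (quot_space K' (push_rel f L')) \<pi>'
      (\<lambda>n. quot_proj (push_rel f L') (f (xs n))) (quot_proj (push_rel f L') (f x))"
    if LL: "L \<in> \<S>" "L' \<in> \<S>" and \<pi>': "natural_projection K' (push_rel f L) (push_rel f L') \<pi>'"
    for L L' \<pi>'
  proof -
    have LK: "L \<in> quots_omega K" and LK': "L' \<in> quots_omega K" using LL S(1) by auto
    \<comment> \<open>The given \<open>\<pi>'\<close> lives over \<open>K'\<close>. Its existence is
      translated into an inclusion of relations, which is carried back to \<open>K\<close> and
      yields a projection \<pi> there.\<close>
    have "quot_le K' (push_rel f L') (push_rel f L)" using \<pi>' by (auto simp: quot_le_def)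
    then have "push_rel f L \<subseteq> push_rel f L'"
      using quot_le_iff[OF eqv eqv] push_rel_quots_omega[OF fg] LK LK' by blast
    then have "L \<subseteq> L'"
      using push_rel_mono push_rel_inverse[OF fg rel[OF LK]] push_rel_inverse[OF fg rel[OF LK']]
      by metis
    then obtain \<pi> where \<pi>: "natural_projection K L L' \<pi>"
      using quot_le_iff[OF eqv[OF LK'] eqv[OF LK]] by (auto simp: quot_le_def)
    have proj: "quot_proj (push_rel f M) (f z) = f ` quot_proj M z"
      if "M \<in> quots_omega K" "z \<in> topspace K" for M z
      unfolding quot_proj_def by (rule push_rel_Image[OF fg rel[OF that(1)] that(2)])
    note hL = homeomorphic_maps_quot_space[OF fg eqv[OF LK]]
    note hL' = homeomorphic_maps_quot_space[OF fg eqv[OF LK']]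
    have "map_fiber_convergent (quot_space K' (push_rel f L)) (quot_space K' (push_rel f L')) \<pi>'
        (\<lambda>n. f ` quot_proj L' (xs n)) (f ` quot_proj L' x)"
    proof (rule map_fiber_convergent_homeomorphic[OF hL _ _ _ _ fcS[OF LL \<pi>]])
      show "continuous_map (quot_space K L') (quot_space K' (push_rel f L')) (image f)"
        using hL' by (simp add: homeomorphic_maps_def)
      have "homeomorphic_map (quot_space K L') (quot_space K' (push_rel f L')) (image f)"
        using hL' by (simp only: homeomorphic_maps_map)
      then show "inj_on (image f) (topspace (quot_space K L'))"
        by (rule homeomorphic_imp_injective_map)
      show "\<pi> ` topspace (quot_space K L) \<subseteq> topspace (quot_space K L')"
        using \<pi> by (simp add: natural_projection_def)
      \<comment> \<open>The square commutes: for a representative \<open>z\<close> of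
        \<open>c\<close>, both sides are the class of \<open>f z\<close> under
        \<open>push_rel f L'\<close>.\<close>
      fix c assume "c \<in> topspace (quot_space K L)"
      then obtain z where z: "z \<in> topspace K" "c = quot_proj L z"
        by (auto simp: quotient_def quot_proj_def)
      have "f z \<in> topspace K'" using cf z(1) by (auto simp: continuous_map_def)
      then have "\<pi>' (quot_proj (push_rel f L) (f z)) = quot_proj (push_rel f L') (f z)"
        using \<pi>' by (simp add: natural_projection_def)
      moreover have "\<pi> c = quot_proj L' z" using \<pi> z by (simp add: natural_projection_def)
      ultimately show "\<pi>' (f ` c) = f ` \<pi> c"
        using proj[OF LK z(1)] proj[OF LK' z(1)] z(2) by simp
    qed
    moreover have "x \<in> topspace K" using l by (rule limitin_topspace)
    moreover have "xs n \<in> topspace K" for n using r by blast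
    ultimately show ?thesis using proj[OF LK'] by simp
  qed
  have "range (\<lambda>n. f (xs n)) \<subseteq> topspace K'"
    using r continuous_map_image_subset_topspace[OF cf] by blast
  moreover have "limitin K' (\<lambda>n. f (xs n)) (f x) sequentially"
    using continuous_map_limit[OF cf l] by (simp add: o_def)
  ultimately show ?thesis
    unfolding fiber_convergent_def using S' cof semi mfc by blast
qed

section \<open>Weak* and norm limits in the dual ball\<close>

lemma topspace_dual_ball [simp]: "topspace dual_ball = cball 0 1"
  by (simp add: dual_ball_def strong_operator_topology_topspace)

lemma limitin_dual_ball:
  assumes "limitin (dual_ball :: ('a::real_normed_vector \<Rightarrow>\<^sub>L real) topology) xs x sequentially"
  shows "(\<lambda>n. blinfun_apply (xs n) v) \<longlonglongrightarrow> blinfun_apply x v"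
proof -
  have "limitin strong_operator_topology xs x sequentially"
    using assms by (simp add: dual_ball_def limitin_subtopology)
  from continuous_map_limit[OF strong_operator_topology_continuous_evaluation[of v] this]
  show ?thesis by (simp add: o_def)
qed

lemma limitin_dual_ball_eq_norm_limit:
  assumes "limitin (dual_ball :: ('a::real_normed_vector \<Rightarrow>\<^sub>L real) topology) xs x sequentially"
    and "xs \<longlonglongrightarrow> y"
  shows "x = y"
proof (rule blinfun_eqI)
  fix v
  have "(\<lambda>n. blinfun_apply (xs n) v) \<longlonglongrightarrow> blinfun_apply y v"
    by (intro tendsto_intros assms(2))
  with limitin_dual_ball[OF assms(1)] show "blinfun_apply x v = blinfun_apply y v"
    by (rule LIMSEQ_unique)
qed

text \<open>The form of the class condition for a single sequence. It does not relate the fiber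
  limit to the norm limit; these are identified separately.\<close>

lemma class_E_iff:
  assumes "class_E TYPE('a::banach)"
  shows "(\<exists>x. fiber_convergent (dual_ball :: ('a \<Rightarrow>\<^sub>L real) topology) xs x) \<longleftrightarrow>
    range xs \<subseteq> cball 0 1 \<and> convergent xs"
  using assms unfolding class_E_def by blast

theorem theorem2:
  fixes f :: "('a::banach \<Rightarrow>\<^sub>L real) \<Rightarrow> ('b::banach \<Rightarrow>\<^sub>L real)"
  assumes "class_E TYPE('a)" and "class_E TYPE('b)"
    and "homeomorphic_map (dual_ball :: ('a \<Rightarrow>\<^sub>L real) topology) (dual_ball :: ('b \<Rightarrow>\<^sub>L real) topology) f"
  shows "continuous_on (cball 0 1) f"
  unfolding continuous_on_sequentially
proof (intro allI ballI impI, elim conjE)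
  fix xs :: "nat \<Rightarrow> 'a \<Rightarrow>\<^sub>L real" and a
  assume "a \<in> cball 0 1" and xs: "\<forall>n. xs n \<in> cball 0 1" "xs \<longlonglongrightarrow> a"
  obtain g where fg: "homeomorphic_maps (dual_ball :: ('a \<Rightarrow>\<^sub>L real) topology) dual_ball f g"
    using assms(3) homeomorphic_map_maps by blast
  obtain x where x: "fiber_convergent dual_ball xs x"
    using class_E_iff[OF assms(1), of xs] xs by (auto simp: convergent_def)
  \<comment> \<open>Fiber convergence includes weak* convergence to \<open>x\<close>, so
    \<open>x\<close> must be the norm limit.\<close>
  then have "x = a"
    using limitin_dual_ball_eq_norm_limit xs(2) by (auto simp: fiber_convergent_def)
  have fx: "fiber_convergent dual_ball (\<lambda>n. f (xs n)) (f x)"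
    by (rule fiber_convergent_homeomorphic[OF fg x])
  then have "convergent (\<lambda>n. f (xs n))"
    using class_E_iff[OF assms(2), of "\<lambda>n. f (xs n)"] by blast
  then obtain y where y: "(\<lambda>n. f (xs n)) \<longlonglongrightarrow> y" by (auto simp: convergent_def)
  \<comment> \<open>The class condition gives only some norm limit \<open>y\<close>; weak*
    convergence to \<open>f x\<close> identifies it.\<close>
  then have "f x = y"
    using limitin_dual_ball_eq_norm_limit fx by (auto simp: fiber_convergent_def)
  with y \<open>x = a\<close> show "(f \<circ> xs) \<longlonglongrightarrow> f a" by (simp add: o_def)
qed

end
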